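(* Let $\mathbb{F}$ be $\mathbb{R}$ or $\mathbb{C}$. Let $\{\mathcal{W}_i\}_{i=1}^n$ be a collection of $m$-dimensional subspaces of $\mathbb{F}^k$, where $1\le m\le k-1$. For each $i\in[n]$ fix an orthonormal basis $\{e_j^i\}_{j=1}^m$ of $\mathcal{W}_i$. Further let $\{U_i\}_{i=1}^n$ be a collection of unitary matrices in $M(\mathbb{F},r,r)$. For each $i\in[n]$ and $j\in[m]$ define $$\overline{e}_j^i = e_j^i\otimes U_i\in M(\mathbb{F},rk,r),\qquad \overline{L}_i=(\overline{e}_1^i\ \overline{e}_2^i\ \cdots\ \overline{e}_m^i)\in M(\mathbb{F},rk,rm),\qquad \overline{\mathcal{W}}_i=\operatorname{col}\overline{L}_i\in Gr(\mathbb{F},rk,rm).$$ Then the following statements hold. 1. For each $i\in[n]$, the columns of $\overline{L}_i$ are a set of $rm$ orthonormal vectors in $\mathbb{F}^{rk}$. 2. $\{\overline{\mathcal{W}}_i\}_{i=1}^n$ is equichordal (not necessarily a fusion frame) if and only if $\{\mathcal{W}_i\}_{i=1}^n$ is. 3. $\{\overline{\mathcal{W}}_i\}_{i=1}^n$ is strongly simplicial (not necessarily a fusion frame) if and only if $\{\mathcal{W}_i\}_{i=1}^n$ is. 4. $\{\overline{\mathcal{W}}_i\}_{i=1}^n$ is equiisoclinic (not necessarily a fusion frame) if and only if $\{\mathcal{W}_i\}_{i=1}^n$ is. 5. $\{\overline{\mathcal{W}}_i\}_{i=1}^n$ saturates the orthoplex bound if and only if $\{\mathcal{W}_i\}_{i=1}^n$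 does, but they cannot both be orthoplectic Grassmannian packings if $r\geq 2$. 6. $\{\overline{\mathcal{W}}_i\}_{i=1}^n$ is a tight fusion frame if and only if $\{\mathcal{W}_i\}_{i=1}^n$ is. In this case, they have the same fusion frame bound.
   Context: Notation: $[n]=\{1,\dots,n\}$; $M(\mathbb{F},p,q)$ is the set of $p\times q$ matrices over $\mathbb{F}$; $\operatorname{col}(A)$ is the column span of $A$; $A\otimes B$ is the Kronecker product, i.e. the block matrix with $(i,j)$ block $a_{i,j}B$ (vectors in $\mathbb{F}^k$ are regarded as $k\times 1$ matrices); $A^\ast$ is the conjugate transpose. $Gr(\mathbb{F},k,m)$ is the collection of $m$-dimensional subspaces of $\mathbb{F}^k$, for $1\le m\le k-1$. The following definitions apply to a collection $\{\mathcal{W}_i\}_{i=1}^n\subset Gr(\mathbb{F},k,m)$ and are used with the appropriate parameters for other collections (for $\{\overline{\mathcal{W}}_i\}$: replace $k,m$ by $rk,rm$). Let $P_i$ be the orthogonal projection onto $\mathcal{W}_i$, and let $L_i$ be a $k\times m$ matrix whose columns form an orthonormal basis of $\mathcal{W}_i$ (so $P_i=L_iL_i^\ast$). - The chordal distance is $d_c(\mathcal{W}_i,\mathcal{W}_j)=[m-\operatorname{tr}(P_iP_j)]^{1/2}$. - Equichordal: $\operatorname{tr}(L_i^\ast L_jL_j^\ast L_i)$ is the same constant for all $i\ne j$ in $[n]$. - Strongly simplicial: $L_i^\ast L_jL_j^\ast L_i$ has the same eigenvalues (counted with multiplicity) for all $i\neq j$ in $[n]$. - Equiisoclinic: there is $\alpha\ge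 0$ such that $L_i^\ast L_jL_j^\ast L_i=\alpha I_m$ for all $i\ne j$ in $[n]$. - Tight fusion frame (with unit weights): there is $A>0$ such that $x=\frac1A\sum_{i=1}^nP_ix$ for all $x\in\mathbb{F}^k$; $A$ is called the fusion frame bound. - Saturating the orthoplex bound: $\min_{i,j\in[n],\,i\ne j}d_c^2(\mathcal{W}_i,\mathcal{W}_j)=\frac{m(k-m)}{k}$. - Let $\mathcal{Z}(\mathbb{C},k)=k^2$ and $\mathcal{Z}(\mathbb{R},k)=\frac{k(k+1)}2$. The collection is an orthoplectic Grassmannian packing if it saturates the orthoplex bound and $\mathcal{Z}(\mathbb{F},k)<n\le 2(\mathcal{Z}(\mathbb{F},k)-1)$. *)

theory Defs
  imports "Jordan_Normal_Form.Schur_Decomposition" "Jordan_Normal_Form.Char_Poly"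
begin

text \<open>
  The two admissible scalar fields. A type of this class comes with an injective, real-linear,
  multiplicative and conjugation-preserving map \<open>cplx\<close> into the complex numbers, whose range is
  either the real line or the whole plane. So, up to isomorphism, its only members are
  \<open>real\<close> and \<open>complex\<close> (both instances are given below).
\<close>

class real_or_complex = conjugatable_ordered_field + real_field +
  fixes cplx :: "'a \<Rightarrow> complex"
  assumes cplx_add: "cplx (x + y) = cplx x + cplx y"
    and cplx_mult: "cplx (x * y) = cplx x * cplx y"
    and cplx_one: "cplx 1 = 1"
    and cplx_scaleR: "cplx (scaleR c x) = scaleR c (cplx x)"
    and cplx_conjugate: "cplx (conjugate x) = cnj (cplx x)"
    and cplx_inj: "cplx x = cplx y \<Longrightarrow> x = y"
    and cplx_range: "range cplx = \<real> \<or> range cplx = UNIV"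

instantiation real :: real_or_complex
begin

definition cplx_real :: "real \<Rightarrow> complex" where
  "cplx_real = complex_of_real"

instance
  by intro_classes (auto simp: cplx_real_def scaleR_conv_of_real Reals_def)

end

instantiation complex :: real_or_complex
begin

definition cplx_complex :: "complex \<Rightarrow> complex" where
  "cplx_complex x = x"

instance
  by intro_classes (auto simp: cplx_complex_def)

end

text \<open>The real dimension of the space of Hermitian (or real symmetric) \<open>k \<times> k\<close> matrices.\<close>

definition zdim :: "'a :: real_or_complex itself \<Rightarrow> nat \<Rightarrow> nat" where
  "zdim _ k = (if range (cplx :: 'a \<Rightarrow> complex) = UNIV then k\<^sup>2 else k * (k + 1) div 2)"

lemma zdim_complex: "zdim TYPE(complex) k = k\<^sup>2"
  by (simp add: zdim_def cplx_complex_def [abs_def])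

lemma zdim_real: "zdim TYPE(real) k = k * (k + 1) div 2"
proof -
  have "\<i> \<notin> range (cplx :: real \<Rightarrow> complex)"
    by (auto simp: cplx_real_def complex_eq_iff)
  then show ?thesis
    by (auto simp: zdim_def)
qed

definition mat_trace :: "'a :: comm_monoid_add mat \<Rightarrow> 'a" where
  "mat_trace A = (\<Sum>i<dim_row A. A $$ (i, i))"

definition unitary_mat :: "nat \<Rightarrow> 'a :: conjugatable_field mat \<Rightarrow> bool" where
  "unitary_mat r U \<longleftrightarrow>
     U \<in> carrier_mat r r \<and> mat_adjoint U * U = 1\<^sub>m r \<and> U * mat_adjoint U = 1\<^sub>m r"

definition kronecker :: "'a :: times mat \<Rightarrow> 'a mat \<Rightarrow> 'a mat" where
  "kronecker A B = mat (dim_row A * dim_row B) (dim_col A * dim_col B)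
     (\<lambda>(a, b). A $$ (a div dim_row B, b div dim_col B) * B $$ (a mod dim_row B, b mod dim_col B))"

text \<open>The block matrix \<open>(B 0, ..., B (m - 1))\<close>, where every block has \<open>nr\<close> rows and \<open>nc\<close> columns.\<close>

definition block_row :: "nat \<Rightarrow> nat \<Rightarrow> nat \<Rightarrow> (nat \<Rightarrow> 'a mat) \<Rightarrow> 'a mat" where
  "block_row nr nc m B = mat nr (nc * m) (\<lambda>(a, b). B (b div nc) $$ (a, b mod nc))"

definition Gr :: "nat \<Rightarrow> nat \<Rightarrow> 'a :: field vec set set" where
  "Gr k m = {W. VectorSpace.subspace class_ring W (module_vec TYPE('a) k) \<and>
                vectorspace.dim class_ring ((module_vec TYPE('a) k)\<lparr>carrier := W\<rparr>) = m}"

definition orthonormal_family :: "nat \<Rightarrow> nat \<Rightarrow> (nat \<Rightarrow> 'a :: conjugatable_field vec) \<Rightarrow> bool" where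
  "orthonormal_family k m v \<longleftrightarrow>
     (\<forall>a<m. v a \<in> carrier_vec k) \<and>
     (\<forall>a<m. \<forall>b<m. v a \<bullet>c v b = (if a = b then 1 else 0))"

definition orthonormal_basis ::
    "nat \<Rightarrow> nat \<Rightarrow> 'a :: conjugatable_field vec set \<Rightarrow> (nat \<Rightarrow> 'a vec) \<Rightarrow> bool" where
  "orthonormal_basis k m W v \<longleftrightarrow>
     orthonormal_family k m v \<and>
     LinearCombinations.module.span class_ring (module_vec TYPE('a) k) (v ` {..<m}) = W"

definition onb_mat ::
    "nat \<Rightarrow> nat \<Rightarrow> 'a :: conjugatable_field vec set \<Rightarrow> 'a mat \<Rightarrow> bool" where
  "onb_mat k m W L \<longleftrightarrow> L \<in> carrier_mat k m \<and> orthonormal_basis k m W (col L)"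

definition orth_proj :: "nat \<Rightarrow> 'a :: conjugatable_field vec set \<Rightarrow> 'a mat" where
  "orth_proj k W = (THE P. P \<in> carrier_mat k k \<and>
     (\<forall>x\<in>carrier_vec k. P *\<^sub>v x \<in> W \<and> (\<forall>w\<in>W. (x - P *\<^sub>v x) \<bullet>c w = 0)))"

text \<open>The trace of a product of two orthogonal projections is real, so \<open>Re\<close> discards nothing.\<close>

definition chordal_dist ::
    "nat \<Rightarrow> nat \<Rightarrow> 'a :: real_or_complex vec set \<Rightarrow> 'a vec set \<Rightarrow> real" where
  "chordal_dist k m V W = sqrt (real m - Re (cplx (mat_trace (orth_proj k V * orth_proj k W))))"

text \<open>
  A collection of \<open>n\<close> subspaces is a function on the indices \<open>0, ..., n - 1\<close>. The next three notions
  are stated for some choice of matrices \<open>L i\<close> whose columns form an orthonormal basis of \<open>W i\<close>;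
  another choice replaces \<open>L i\<close> by \<open>L i\<close> times a unitary matrix and does not affect them.
\<close>

definition cross_gram :: "'a :: conjugatable_field mat \<Rightarrow> 'a mat \<Rightarrow> 'a mat" where
  "cross_gram L M = mat_adjoint L * M * mat_adjoint M * L"

definition equichordal ::
    "nat \<Rightarrow> nat \<Rightarrow> nat \<Rightarrow> (nat \<Rightarrow> 'a :: conjugatable_field vec set) \<Rightarrow> bool" where
  "equichordal k m n W \<longleftrightarrow>
     (\<exists>L. (\<forall>i<n. onb_mat k m (W i) (L i)) \<and>
       (\<exists>c. \<forall>i<n. \<forall>j<n. i \<noteq> j \<longrightarrow> mat_trace (cross_gram (L i) (L j)) = c))"

text \<open>
  The multiset of roots of the characteristic polynomial is the multiset of eigenvalues
  in the scalar field; for the Hermitian matrices considered here these are all the eigenvalues.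
\<close>

definition strongly_simplicial ::
    "nat \<Rightarrow> nat \<Rightarrow> nat \<Rightarrow> (nat \<Rightarrow> 'a :: conjugatable_field vec set) \<Rightarrow> bool" where
  "strongly_simplicial k m n W \<longleftrightarrow>
     (\<exists>L. (\<forall>i<n. onb_mat k m (W i) (L i)) \<and>
       (\<exists>E. \<forall>i<n. \<forall>j<n. i \<noteq> j \<longrightarrow> proots (char_poly (cross_gram (L i) (L j))) = E))"

definition equiisoclinic ::
    "nat \<Rightarrow> nat \<Rightarrow> nat \<Rightarrow> (nat \<Rightarrow> 'a :: real_or_complex vec set) \<Rightarrow> bool" where
  "equiisoclinic k m n W \<longleftrightarrow>
     (\<exists>L. (\<forall>i<n. onb_mat k m (W i) (L i)) \<and>
       (\<exists>\<alpha>::real. \<alpha> \<ge> 0 \<and>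
         (\<forall>i<n. \<forall>j<n. i \<noteq> j \<longrightarrow> cross_gram (L i) (L j) = of_real \<alpha> \<cdot>\<^sub>m 1\<^sub>m m)))"

definition fusion_frame_bound ::
    "nat \<Rightarrow> nat \<Rightarrow> (nat \<Rightarrow> 'a :: real_or_complex vec set) \<Rightarrow> real \<Rightarrow> bool" where
  "fusion_frame_bound k n W A \<longleftrightarrow> A > 0 \<and>
     (\<forall>x\<in>carrier_vec k.
       x = of_real (1 / A) \<cdot>\<^sub>v finsum_vec TYPE('a) k (\<lambda>i. orth_proj k (W i) *\<^sub>v x) {..<n})"

definition tight_fusion_frame ::
    "nat \<Rightarrow> nat \<Rightarrow> (nat \<Rightarrow> 'a :: real_or_complex vec set) \<Rightarrow> bool" where
  "tight_fusion_frame k n W \<longleftrightarrow> (\<exists>A. fusion_frame_bound k n W A)"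

text \<open>For \<open>n < 2\<close> there is no pair of distinct indices, hence no minimum.\<close>

definition saturates_orthoplex ::
    "nat \<Rightarrow> nat \<Rightarrow> nat \<Rightarrow> (nat \<Rightarrow> 'a :: real_or_complex vec set) \<Rightarrow> bool" where
  "saturates_orthoplex k m n W \<longleftrightarrow> n \<ge> 2 \<and>
     Min {(chordal_dist k m (W i) (W j))\<^sup>2 | i j. i < n \<and> j < n \<and> i \<noteq> j}
       = real m * (real k - real m) / real k"

definition orthoplectic_packing ::
    "nat \<Rightarrow> nat \<Rightarrow> nat \<Rightarrow> (nat \<Rightarrow> 'a :: real_or_complex vec set) \<Rightarrow> bool" where
  "orthoplectic_packing k m n W \<longleftrightarrow>
     saturates_orthoplex k m n W \<and> zdim TYPE('a) k < n \<and> n \<le> 2 * (zdim TYPE('a) k - 1)"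

end

theory Submission
  imports Defs "Jordan_Normal_Form.DL_Rank"
begin

text \<open>
  Let \<open>L\<^sub>i\<close> be the matrix whose columns are the given orthonormal basis of \<open>W\<^sub>i\<close>. Placing the blocks
  \<open>e\<^sub>j \<otimes> U\<^sub>i\<close> side by side gives \<open>L\<^sub>i \<otimes> U\<^sub>i\<close> (lemma \<open>block_row_kronecker\<close>), and everything follows from
  the rules \<open>(A \<otimes> B)(C \<otimes> D) = AC \<otimes> BD\<close> and \<open>(A \<otimes> B)\<^sup>* = A\<^sup>* \<otimes> B\<^sup>*\<close>, because the unitary factors cancel
  in each quantity of interest:

  \<^item> the Gram matrix of the columns is \<open>L\<^sup>*L \<otimes> U\<^sup>*U = I\<close>, so the columns are orthonormal;
  \<^item> the orthogonal projection is \<open>LL\<^sup>* \<otimes> UU\<^sup>* = P \<otimes> I\<close>;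
  \<^item> the cross Gram matrix \<open>L\<^sup>*MM\<^sup>*L\<close> of two subspaces becomes \<open>G \<otimes> I\<close>, where \<open>G\<close> is the original one.

  It remains to see what passing from \<open>A\<close> to \<open>A \<otimes> I\<close> does. It multiplies traces by \<open>r\<close>. As the
  dimensions \<open>k\<close> and \<open>m\<close> grow by the same factor, so do the squared chordal distances and the orthoplex
  bound \<open>m(k - m)/k\<close> with which they are compared. The step from \<open>A\<close> to \<open>A \<otimes> I\<close>
  also raises the characteristic polynomial to the power \<open>r\<close> (lemma \<open>char_poly_kronecker_one\<close>), so
  every multiplicity is multiplied by \<open>r\<close>. It is injective and maps \<open>\<alpha> I\<close> to \<open>\<alpha> I\<close>. Each of these operations can be undone, which gives the equivalences. A collection
  is a tight fusion frame with bound \<open>A\<close> exactly when its projections sum to \<open>A I\<close>, and that identity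
  holds for the \<open>P\<^sub>i\<close> if and only if it holds for the \<open>P\<^sub>i \<otimes> I\<close>. The two collections cannot both be
  orthoplectic packings for \<open>r \<ge> 2\<close>, because already \<open>2(Z(k) - 1) \<le> Z(rk)\<close> for the dimension \<open>Z\<close> of
  the space of Hermitian matrices.

  Three of the notions only ask for some orthonormal bases of the subspaces. Another choice of bases
  conjugates each cross Gram matrix by a unitary matrix, so these notions may be evaluated on
  the bases \<open>L\<^sub>i\<close> and \<open>L\<^sub>i \<otimes> U\<^sub>i\<close> (lemma \<open>cross_gram_choice\<close>).
\<close>

section \<open>Adjoints and traces\<close>

lemma mat_adjoint_carrier [simp]: "A \<in> carrier_mat p q \<Longrightarrow> mat_adjoint A \<in> carrier_mat q p"
  by (auto simp: mat_adjoint_def)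

lemma mat_adjoint_dim [simp]:
  "dim_row (mat_adjoint A) = dim_col A" "dim_col (mat_adjoint A) = dim_row A"
  by (auto simp: mat_adjoint_def)

lemma mat_adjoint_index [simp]:
  "i < dim_col A \<Longrightarrow> j < dim_row A \<Longrightarrow> mat_adjoint A $$ (i, j) = conjugate (A $$ (j, i))"
  by (auto simp: mat_adjoint_def mat_of_rows_def)

lemma mat_mult_index:
  "A \<in> carrier_mat p q \<Longrightarrow> B \<in> carrier_mat q s \<Longrightarrow> i < p \<Longrightarrow> j < s \<Longrightarrow>
   (A * B) $$ (i, j) = (\<Sum>l<q. A $$ (i, l) * B $$ (l, j))"
  by (auto simp: scalar_prod_def atLeast0LessThan intro!: sum.cong)

text \<open>
  Stated with dimensions instead of carriers, associativity is a rewrite rule whose conditions are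
  decided by rewriting: there is no inner dimension left to be guessed.
\<close>

lemma mat_mult_assoc_dim:
  "dim_col A = dim_row B \<Longrightarrow> dim_col B = dim_row C \<Longrightarrow> (A * B) * C = A * (B * (C :: 'a :: semiring_0 mat))"
  by (rule assoc_mult_mat) auto

lemma mat_adjoint_mult:
  fixes A :: "'a :: conjugatable_field mat"
  assumes "A \<in> carrier_mat p q" "B \<in> carrier_mat q s"
  shows "mat_adjoint (A * B) = mat_adjoint B * mat_adjoint A"
proof (rule eq_matI)
  fix i j assume "i < dim_row (mat_adjoint B * mat_adjoint A)"
    "j < dim_col (mat_adjoint B * mat_adjoint A)"
  with assms have ij: "i < s" "j < p" by auto
  have "mat_adjoint (A * B) $$ (i, j) = (\<Sum>l<q. conjugate (A $$ (j, l) * B $$ (l, i)))"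
    using assms ij by (simp add: mat_mult_index[OF assms] sum_conjugate del: index_mult_mat(1))
  also have "\<dots> = (\<Sum>l<q. mat_adjoint B $$ (i, l) * mat_adjoint A $$ (l, j))"
    using assms ij by (auto simp: conjugate_dist_mul mult.commute intro!: sum.cong)
  also have "\<dots> = (mat_adjoint B * mat_adjoint A) $$ (i, j)"
    using assms ij by (subst mat_mult_index[of _ s q _ p]) auto
  finally show "mat_adjoint (A * B) $$ (i, j) = (mat_adjoint B * mat_adjoint A) $$ (i, j)" .
qed (use assms in auto)

lemma mat_trace_comm:
  fixes A :: "'a :: comm_ring_1 mat"
  assumes "A \<in> carrier_mat p q" "B \<in> carrier_mat q p"
  shows "mat_trace (A * B) = mat_trace (B * A)"
proof -
  have "mat_trace (A * B) = (\<Sum>i<p. \<Sum>l<q. A $$ (i, l) * B $$ (l, i))"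
    using assms by (auto simp: mat_trace_def mat_mult_index[OF assms] simp del: index_mult_mat(1)
      intro!: sum.cong)
  also have "\<dots> = (\<Sum>l<q. \<Sum>i<p. B $$ (l, i) * A $$ (i, l))"
    by (subst sum.swap) (simp add: mult.commute)
  also have "\<dots> = mat_trace (B * A)"
    using assms by (auto simp: mat_trace_def mat_mult_index[OF assms(2,1)] simp del: index_mult_mat(1)
      intro!: sum.cong)
  finally show ?thesis .
qed

section \<open>The Kronecker product\<close>

lemma div_mod_less_prod:
  "(a :: nat) < p * s \<Longrightarrow> a div s < p" "(a :: nat) < p * s \<Longrightarrow> a mod s < s"
  by (auto simp: less_mult_imp_div_less) (metis mod_less_divisor mult_0_right neq0_conv not_less0)

lemma mult_add_less_prod: "(i :: nat) < p \<Longrightarrow> s < r \<Longrightarrow> i * r + s < p * r"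
  using mult_le_mono1[of "Suc i" p r] by simp

text \<open>Quotient and remainder identify the indices below \<open>p * s\<close> with pairs. Applied to the inner
  index of a product of Kronecker products, this splits its entries into two independent sums.\<close>

lemma sum_div_mod:
  fixes f :: "nat \<Rightarrow> nat \<Rightarrow> 'a :: comm_monoid_add"
  shows "(\<Sum>a<p * s. f (a div s) (a mod s)) = (\<Sum>i<p. \<Sum>t<s. f i t)"
proof -
  have "(\<Sum>a<p * s. f (a div s) (a mod s))
      = (\<Sum>i<p. \<Sum>a=i*s..<i*s+s. f (a div s) (a mod s))"
    by (rule sum.nat_group[symmetric])
  also have "\<dots> = (\<Sum>i<p. \<Sum>t<s. f i t)"
  proof (rule sum.cong[OF refl])
    fix i
    have "(\<Sum>a=i*s..<i*s+s. f (a div s) (a mod s))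
        = (\<Sum>t=0..<s. f ((t + i*s) div s) ((t + i*s) mod s))"
      using sum.shift_bounds_nat_ivl[of "\<lambda>a. f (a div s) (a mod s)" 0 "i*s" s]
      by (simp add: add.commute)
    then show "(\<Sum>a=i*s..<i*s+s. f (a div s) (a mod s)) = (\<Sum>t<s. f i t)"
      by (auto simp: atLeast0LessThan intro!: sum.cong)
  qed
  finally show ?thesis .
qed

lemma kronecker_dim [simp]:
  "dim_row (kronecker A B) = dim_row A * dim_row B"
  "dim_col (kronecker A B) = dim_col A * dim_col B"
  by (auto simp: kronecker_def)

lemma kronecker_carrier:
  "A \<in> carrier_mat p q \<Longrightarrow> B \<in> carrier_mat s t \<Longrightarrow> kronecker A B \<in> carrier_mat (p * s) (q * t)"
  by (auto simp: kronecker_def)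

lemma kronecker_index:
  "A \<in> carrier_mat p q \<Longrightarrow> B \<in> carrier_mat s t \<Longrightarrow> a < p * s \<Longrightarrow> b < q * t \<Longrightarrow>
   kronecker A B $$ (a, b) = A $$ (a div s, b div t) * B $$ (a mod s, b mod t)"
  by (auto simp: kronecker_def)

lemma kronecker_mult:
  fixes A :: "'a :: comm_ring_1 mat"
  assumes A: "A \<in> carrier_mat p q" and B: "B \<in> carrier_mat s t"
    and C: "C \<in> carrier_mat q u" and D: "D \<in> carrier_mat t v"
  shows "kronecker A B * kronecker C D = kronecker (A * C) (B * D)"
proof (rule eq_matI)
  fix a b assume "a < dim_row (kronecker (A * C) (B * D))" "b < dim_col (kronecker (A * C) (B * D))"
  with assms have ab: "a < p * s" "b < u * v" by auto
  note dm = div_mod_less_prod[OF ab(1)] div_mod_less_prod[OF ab(2)]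
  have "(kronecker A B * kronecker C D) $$ (a, b)
      = (\<Sum>c<q * t. kronecker A B $$ (a, c) * kronecker C D $$ (c, b))"
    by (rule mat_mult_index[OF kronecker_carrier[OF A B] kronecker_carrier[OF C D] ab])
  also have "\<dots> = (\<Sum>c<q * t. (A $$ (a div s, c div t) * B $$ (a mod s, c mod t)) *
      (C $$ (c div t, b div v) * D $$ (c mod t, b mod v)))"
    using ab by (auto simp: kronecker_index[OF A B] kronecker_index[OF C D] intro!: sum.cong)
  also have "\<dots> = (\<Sum>i<q. \<Sum>j<t. (A $$ (a div s, i) * B $$ (a mod s, j)) *
      (C $$ (i, b div v) * D $$ (j, b mod v)))"
    by (rule sum_div_mod)
  also have "\<dots> = (\<Sum>i<q. A $$ (a div s, i) * C $$ (i, b div v)) *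
      (\<Sum>j<t. B $$ (a mod s, j) * D $$ (j, b mod v))"
    by (simp add: sum_product mult_ac)
  also have "\<dots> = (A * C) $$ (a div s, b div v) * (B * D) $$ (a mod s, b mod v)"
    using dm by (simp add: mat_mult_index[OF A C] mat_mult_index[OF B D] del: index_mult_mat(1))
  also have "\<dots> = kronecker (A * C) (B * D) $$ (a, b)"
    using ab by (subst kronecker_index[of _ p u _ s v]) (use assms in auto)
  finally show "(kronecker A B * kronecker C D) $$ (a, b) = kronecker (A * C) (B * D) $$ (a, b)" .
qed (use assms in auto)

lemma mat_adjoint_kronecker:
  fixes A :: "'a :: conjugatable_field mat"
  shows "mat_adjoint (kronecker A B) = kronecker (mat_adjoint A) (mat_adjoint B)"
  by (rule eq_matI) (auto simp: kronecker_def conjugate_dist_mul div_mod_less_prod)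

lemma kronecker_one_one: "kronecker (1\<^sub>m p) (1\<^sub>m r) = (1\<^sub>m (p * r) :: 'a :: comm_ring_1 mat)"
proof (rule eq_matI)
  fix a b assume "a < dim_row (1\<^sub>m (p * r) :: 'a mat)" "b < dim_col (1\<^sub>m (p * r) :: 'a mat)"
  then have ab: "a < p * r" "b < p * r" by auto
  have "a = b \<longleftrightarrow> a div r = b div r \<and> a mod r = b mod r"
    by (metis div_mult_mod_eq)
  then show "kronecker (1\<^sub>m p) (1\<^sub>m r) $$ (a, b) = (1\<^sub>m (p * r) :: 'a mat) $$ (a, b)"
    using ab by (auto simp: kronecker_def div_mod_less_prod)
qed auto

lemma kronecker_smult_left:
  "kronecker (c \<cdot>\<^sub>m A) B = (c :: 'a :: comm_ring_1) \<cdot>\<^sub>m kronecker A B"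
  by (rule eq_matI) (auto simp: kronecker_def div_mod_less_prod mult.assoc)

lemma kronecker_one_inj:
  fixes A B :: "'a :: comm_ring_1 mat"
  assumes A: "A \<in> carrier_mat p q" and B: "B \<in> carrier_mat p q" and r: "0 < r"
    and eq: "kronecker A (1\<^sub>m r) = kronecker B (1\<^sub>m r)"
  shows "A = B"
proof (rule eq_matI)
  fix i j assume "i < dim_row B" "j < dim_col B"
  then have ij: "i * r + 0 < p * r" "j * r + 0 < q * r"
    using B r by auto
  \<comment> \<open>the top left entry of block \<open>(i, j)\<close> of \<open>A \<otimes> I\<close> is the entry \<open>(i, j)\<close> of \<open>A\<close>\<close>
  have "kronecker A (1\<^sub>m r) $$ (i * r + 0, j * r + 0) = kronecker B (1\<^sub>m r) $$ (i * r + 0, j * r + 0)"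
    by (simp only: eq)
  then show "A $$ (i, j) = B $$ (i, j)"
    using r ij by (simp add: kronecker_index[OF A one_carrier_mat] kronecker_index[OF B one_carrier_mat])
qed (use assms in auto)

lemma mat_trace_kronecker_one:
  fixes A :: "'a :: comm_ring_1 mat"
  assumes A: "A \<in> carrier_mat p p"
  shows "mat_trace (kronecker A (1\<^sub>m r)) = of_nat r * mat_trace A"
proof -
  have "mat_trace (kronecker A (1\<^sub>m r)) = (\<Sum>a<p * r. A $$ (a div r, a div r))"
    using A by (auto simp: mat_trace_def kronecker_def div_mod_less_prod intro!: sum.cong)
  also have "\<dots> = (\<Sum>i<p. \<Sum>t<r. A $$ (i, i))"
    by (rule sum_div_mod)
  finally show ?thesis
    using A by (simp add: mat_trace_def sum_distrib_left)
qed

section \<open>The characteristic polynomial of \<open>A \<otimes> I\<close>\<close>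

text \<open>\<open>I \<otimes> A\<close> is block diagonal with \<open>r\<close> blocks \<open>A\<close>; the induction splits off the first of them.\<close>

lemma det_kronecker_one_left:
  fixes A :: "'a :: idom mat"
  assumes A: "A \<in> carrier_mat d d"
  shows "det (kronecker (1\<^sub>m r) A) = det A ^ r"
proof (induction r)
  case 0
  then show ?case using A by (simp add: det_dim_zero kronecker_def)
next
  case (Suc r)
  have "kronecker (1\<^sub>m (Suc r)) A
      = four_block_mat A (0\<^sub>m d (r * d)) (0\<^sub>m (r * d) d) (kronecker (1\<^sub>m r) A)"
  proof (rule eq_matI)
    fix a b assume "a < dim_row (four_block_mat A (0\<^sub>m d (r * d)) (0\<^sub>m (r * d) d) (kronecker (1\<^sub>m r) A))"
      "b < dim_col (four_block_mat A (0\<^sub>m d (r * d)) (0\<^sub>m (r * d) d) (kronecker (1\<^sub>m r) A))"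
    then have ab: "a < Suc r * d" "b < Suc r * d" using A by auto
    then have d: "d > 0" by (cases d) auto
    have ix: "x div d = (if x < d then 0 else Suc ((x - d) div d))"
      "x mod d = (if x < d then x else (x - d) mod d)" for x
      using d by (auto simp: le_div_geq le_mod_geq)
    have lt: "(x - d) div d < r" if "x < Suc r * d" "\<not> x < d" for x
      using that by (intro less_mult_imp_div_less) auto
    show "kronecker (1\<^sub>m (Suc r)) A $$ (a, b)
      = four_block_mat A (0\<^sub>m d (r * d)) (0\<^sub>m (r * d) d) (kronecker (1\<^sub>m r) A) $$ (a, b)"
      using A ab d lt[of a] lt[of b]
      by (auto simp: kronecker_def ix[of a] ix[of b])
  qed (use A in auto)
  then have "det (kronecker (1\<^sub>m (Suc r)) A) = det A * det (kronecker (1\<^sub>m r) A)"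
    using A kronecker_carrier[OF one_carrier_mat A, of r]
    by (simp add: det_four_block_mat_upper_right_zero[OF A refl])
  then show ?case by (simp add: Suc)
qed

text \<open>The row and the column permutation contribute the same sign, and its square is 1.\<close>

lemma det_permute_rows_cols:
  assumes A: "A \<in> carrier_mat N N" and p: "p permutes {0..<N}"
  shows "det (mat N N (\<lambda>(i, j). A $$ (p i, p j))) = det (A :: 'a :: comm_ring_1 mat)"
proof -
  let ?B = "mat N N (\<lambda>(i, j). A $$ (p i, j))"
  let ?C = "mat N N (\<lambda>(i, j). ?B\<^sup>T $$ (p i, j))"
  have p_lt: "p i < N" if "i < N" for i
    using permutes_in_image[OF p, of i] that by auto
  have "mat N N (\<lambda>(i, j). A $$ (p i, p j)) = ?C\<^sup>T"
    using p_lt by (intro eq_matI) auto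
  also have "det \<dots> = signof p * det ?B\<^sup>T"
    by (subst det_transpose[of _ N], simp, rule det_permute_rows[OF _ p]) simp
  also have "det ?B\<^sup>T = signof p * det A"
    by (subst det_transpose[of _ N], simp, rule det_permute_rows[OF A p])
  finally show ?thesis
    by (simp add: sign_def mult.assoc[symmetric])
qed

text \<open>Reordering the pairs of indices by exchanging their components turns \<open>A \<otimes> I\<close> into \<open>I \<otimes> A\<close>.\<close>

lemma det_kronecker_one_right:
  fixes A :: "'a :: idom mat"
  assumes A: "A \<in> carrier_mat d d"
  shows "det (kronecker A (1\<^sub>m r)) = det A ^ r"
proof -
  \<comment> \<open>\<open>p\<close> maps the index of the pair \<open>(s, i)\<close> with \<open>s < r\<close>, \<open>i < d\<close> to the index of \<open>(i, s)\<close>\<close>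
  define p where "p a = (if a < r * d then (a mod d) * r + a div d else a)" for a
  have dm: "a div d < r" "a mod d < d" if "a < r * d" for a
    using div_mod_less_prod[OF that] by auto
  have p_lt: "p a < r * d" if "a < r * d" for a
    using mult_add_less_prod[OF dm(2,1), of a a] that by (simp add: p_def mult.commute)
  have p_div: "p a div r = a mod d" "p a mod r = a div d" if "a < r * d" for a
    using dm[OF that] that by (auto simp: p_def)
  have inj: "inj_on p {0..<r * d}"
    by (rule inj_onI) (metis p_div div_mult_mod_eq atLeastLessThan_iff)
  have "p permutes {0..<r * d}"
  proof (rule bij_imp_permutes)
    have "p ` {0..<r * d} \<subseteq> {0..<r * d}"
      using p_lt by auto
    then show "bij_betw p {0..<r * d} {0..<r * d}"
      using inj endo_inj_surj[of "{0..<r * d}" p] unfolding bij_betw_def by blast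
  qed (auto simp: p_def)
  then have "det (kronecker A (1\<^sub>m r))
      = det (mat (r * d) (r * d) (\<lambda>(a, b). kronecker A (1\<^sub>m r) $$ (p a, p b)))"
    using kronecker_carrier[OF A one_carrier_mat, of r]
    by (intro det_permute_rows_cols[symmetric]) (auto simp: mult.commute)
  also have "mat (r * d) (r * d) (\<lambda>(a, b). kronecker A (1\<^sub>m r) $$ (p a, p b)) = kronecker (1\<^sub>m r) A"
  proof (rule eq_matI)
    fix a b assume "a < dim_row (kronecker (1\<^sub>m r) A)" "b < dim_col (kronecker (1\<^sub>m r) A)"
    then have ab: "a < r * d" "b < r * d" using A by auto
    then have "p a < d * r" "p b < d * r"
      using p_lt by (auto simp: mult.commute)
    with ab show "mat (r * d) (r * d) (\<lambda>(a, b). kronecker A (1\<^sub>m r) $$ (p a, p b)) $$ (a, b)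
        = kronecker (1\<^sub>m r) A $$ (a, b)"
      using dm[OF ab(1)] dm[OF ab(2)]
      by (simp add: kronecker_index[OF A one_carrier_mat] kronecker_index[OF one_carrier_mat A] p_div)
  qed (use A in auto)
  finally show ?thesis
    by (simp add: det_kronecker_one_left[OF A])
qed

text \<open>The matrix \<open>x I - A \<otimes> I\<close> is \<open>(x I - A) \<otimes> I\<close>, so this is the determinant formula
  over the polynomial ring.\<close>

lemma char_poly_kronecker_one:
  fixes A :: "'a :: idom mat"
  assumes A: "A \<in> carrier_mat d d"
  shows "char_poly (kronecker A (1\<^sub>m r)) = char_poly A ^ r"
proof -
  have "char_poly_matrix (kronecker A (1\<^sub>m r)) = kronecker (char_poly_matrix A) (1\<^sub>m r)"
  proof (rule eq_matI)
    fix a b assume "a < dim_row (kronecker (char_poly_matrix A) (1\<^sub>m r))"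
      "b < dim_col (kronecker (char_poly_matrix A) (1\<^sub>m r))"
    then have ab: "a < d * r" "b < d * r"
      using A by (auto simp: char_poly_matrix_def)
    have "a = b \<longleftrightarrow> a div r = b div r \<and> a mod r = b mod r"
      by (metis div_mult_mod_eq)
    then show "char_poly_matrix (kronecker A (1\<^sub>m r)) $$ (a, b)
        = kronecker (char_poly_matrix A) (1\<^sub>m r) $$ (a, b)"
      using A ab div_mod_less_prod[OF ab(1)] div_mod_less_prod[OF ab(2)]
      by (auto simp: char_poly_matrix_def kronecker_def)
  qed (use A in \<open>auto simp: char_poly_matrix_def\<close>)
  then show ?thesis
    using det_kronecker_one_right[of "char_poly_matrix A" d r] A
    by (simp add: char_poly_def)
qed

section \<open>Orthonormal bases and orthogonal projections\<close>

lemma orthonormal_family_iff_adjoint: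
  fixes L :: "'a :: conjugatable_field mat"
  assumes L: "L \<in> carrier_mat k m"
  shows "orthonormal_family k m (col L) \<longleftrightarrow> mat_adjoint L * L = 1\<^sub>m m"
proof -
  have "(mat_adjoint L * L) $$ (a, b) = col L b \<bullet>c col L a" if "a < m" "b < m" for a b
    using L that by (auto simp: scalar_prod_def mult.commute intro!: sum.cong)
  moreover have "mat_adjoint L * L = 1\<^sub>m m \<longleftrightarrow>
      (\<forall>a<m. \<forall>b<m. (mat_adjoint L * L) $$ (a, b) = (if a = b then 1 else 0))"
    using L by (auto simp: mat_eq_iff)
  moreover have "col L a \<in> carrier_vec k" for a
    using L by auto
  ultimately show ?thesis
    unfolding orthonormal_family_def by (metis (no_types, lifting))
qed

text \<open>The matrix form of an orthonormal basis, which reduces the rest to matrix algebra.\<close>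

lemma onb_mat_iff:
  fixes L :: "'a :: conjugatable_field mat"
  shows "onb_mat k m W L \<longleftrightarrow>
    L \<in> carrier_mat k m \<and> mat_adjoint L * L = 1\<^sub>m m \<and> W = (\<lambda>c. L *\<^sub>v c) ` carrier_vec m"
proof (cases "L \<in> carrier_mat k m")
  case True
  interpret vec_space "TYPE('a)" k .
  have "set (cols L) = col L ` {..<m}"
    using True by (auto simp: cols_def)
  then have "span (col L ` {..<m}) = (\<lambda>c. L *\<^sub>v c) ` carrier_vec m"
    using col_space_eq[OF True] True unfolding col_space_def by auto
  then show ?thesis
    using True orthonormal_family_iff_adjoint[OF True]
    unfolding onb_mat_def orthonormal_basis_def by auto
qed (auto simp: onb_mat_def)

lemma onb_mat_col_space:
  fixes L :: "'a :: conjugatable_field mat"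
  assumes L: "L \<in> carrier_mat k m" and "mat_adjoint L * L = 1\<^sub>m m"
  shows "onb_mat k m (vec_space.col_space k L) L"
  using assms vec_space.col_space_eq[OF L] by (auto simp: onb_mat_iff)

text \<open>\<open>L\<^sup>*\<close> is a left inverse of \<open>L\<close>, so \<open>L\<close> is injective; its columns are then distinct and linearly
  independent, and their number is the dimension of their span.\<close>

lemma onb_mat_imp_Gr:
  fixes L :: "'a :: conjugatable_field mat"
  assumes onb: "onb_mat k m W L"
  shows "W \<in> Gr k m"
proof -
  interpret vec_space "TYPE('a)" k .
  have L: "L \<in> carrier_mat k m" and LL: "mat_adjoint L * L = 1\<^sub>m m"
    and W: "W = (\<lambda>c. L *\<^sub>v c) ` carrier_vec m"
    using onb by (auto simp: onb_mat_iff)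
  have W: "W = span (set (cols L))"
    using W col_space_eq[OF L] L unfolding col_space_def by auto
  have inj: "v = w" if "v \<in> carrier_vec m" "w \<in> carrier_vec m" "L *\<^sub>v v = L *\<^sub>v w" for v w
  proof -
    have "mat_adjoint L *\<^sub>v (L *\<^sub>v v) = mat_adjoint L *\<^sub>v (L *\<^sub>v w)"
      using that by simp
    then have "(mat_adjoint L * L) *\<^sub>v v = (mat_adjoint L * L) *\<^sub>v w"
      using that L by (simp add: assoc_mult_mat_vec[of _ m k _ m])
    then show ?thesis using that by (simp add: LL)
  qed
  have dist: "distinct (cols L)"
  proof -
    have "i = j" if "i < m" "j < m" "col L i = col L j" for i j
    proof -
      have "(mat_adjoint L * L) $$ (i, i) = (mat_adjoint L * L) $$ (i, j)"
        using that L by simp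
      then show ?thesis
        using that unfolding LL by (simp split: if_splits)
    qed
    then show ?thesis
      using L by (auto simp: distinct_conv_nth)
  qed
  have indpt: "lin_indpt (set (cols L))"
  proof
    assume "lin_dep (set (cols L))"
    then obtain v where v: "v \<in> carrier_vec m" "v \<noteq> 0\<^sub>v m" "L *\<^sub>v v = 0\<^sub>v k"
      using lin_depE[OF L _ dist] by blast
    have "L *\<^sub>v 0\<^sub>v m = 0\<^sub>v k"
      using carrier_matD[OF L] by (intro eq_vecI) (simp_all add: scalar_prod_def)
    with v(3) have "v = 0\<^sub>v m"
      by (intro inj[OF v(1) zero_carrier_vec]) simp
    with v(2) show False by blast
  qed
  have "vectorspace.dim class_ring (span_vs (set (cols L))) = m"
    using lin_indpt_full_rank[OF L dist indpt] by (simp add: rank_def)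
  moreover have "VectorSpace.subspace class_ring (span (set (cols L))) V"
    using L cols_dim[of L] by (intro span_is_subspace) auto
  ultimately show ?thesis
    unfolding Gr_def W by blast
qed

text \<open>A matrix \<open>P\<close> has the properties of the projection only if \<open>P x = L c\<close> for some \<open>c\<close> and
  \<open>L\<^sup>*(x - P x) = 0\<close>. As \<open>L\<^sup>*L = I\<close>, this forces \<open>c = L\<^sup>*x\<close>, hence \<open>P = LL\<^sup>*\<close>.\<close>

lemma orth_proj_eq:
  fixes L :: "'a :: conjugatable_field mat"
  assumes onb: "onb_mat k m W L"
  shows "orth_proj k W = L * mat_adjoint L"
proof -
  have L [simp]: "L \<in> carrier_mat k m" and LL: "mat_adjoint L * L = 1\<^sub>m m"
    and W: "W = (\<lambda>c. L *\<^sub>v c) ` carrier_vec m"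
    using onb by (auto simp: onb_mat_iff)
  have La [simp]: "mat_adjoint L \<in> carrier_mat m k" by simp
  let ?Q = "L * mat_adjoint L"
  have Q [simp]: "?Q \<in> carrier_mat k k" by (rule mult_carrier_mat[OF L La])
  have LaQ: "mat_adjoint L * ?Q = mat_adjoint L"
    by (simp only: assoc_mult_mat[symmetric, OF La L La] LL left_mult_one_mat[OF La])
  \<comment> \<open>\<open>v\<close> is orthogonal to the column space of \<open>L\<close> exactly when \<open>L\<^sup>* v = 0\<close>\<close>
  have inner: "v \<bullet>c (L *\<^sub>v c) = (mat_adjoint L *\<^sub>v v) \<bullet>c c"
    if v: "v \<in> carrier_vec k" and c: "c \<in> carrier_vec m" for v c
  proof -
    note dims = carrier_matD[OF L] carrier_vecD[OF v] carrier_vecD[OF c]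
    have "v \<bullet>c (L *\<^sub>v c) = (\<Sum>p<k. v $ p * conjugate (\<Sum>a<m. L $$ (p, a) * c $ a))"
      by (simp add: scalar_prod_def atLeast0LessThan dims cong: sum.cong_simp)
    also have "\<dots> = (\<Sum>p<k. \<Sum>a<m. conjugate (L $$ (p, a)) * v $ p * conjugate (c $ a))"
      by (simp add: sum_conjugate conjugate_dist_mul sum_distrib_left mult_ac)
    also have "\<dots> = (\<Sum>a<m. \<Sum>p<k. conjugate (L $$ (p, a)) * v $ p * conjugate (c $ a))"
      by (rule sum.swap)
    also have "\<dots> = (\<Sum>a<m. (\<Sum>p<k. conjugate (L $$ (p, a)) * v $ p) * conjugate (c $ a))"
      by (simp only: sum_distrib_right)
    also have "\<dots> = (mat_adjoint L *\<^sub>v v) \<bullet>c c"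
      by (simp add: scalar_prod_def atLeast0LessThan dims cong: sum.cong_simp)
    finally show ?thesis .
  qed
  let ?proj = "\<lambda>P. P \<in> carrier_mat k k \<and>
     (\<forall>x\<in>carrier_vec k. P *\<^sub>v x \<in> W \<and> (\<forall>w\<in>W. (x - P *\<^sub>v x) \<bullet>c w = 0))"
  have "?proj ?Q"
  proof (intro conjI ballI)
    fix x :: "'a vec" assume x: "x \<in> carrier_vec k"
    have Qx: "?Q *\<^sub>v x = L *\<^sub>v (mat_adjoint L *\<^sub>v x)"
      by (rule assoc_mult_mat_vec[OF L La x])
    then show "?Q *\<^sub>v x \<in> W"
      using x by (auto simp: W intro!: imageI mult_mat_vec_carrier[OF La])
    fix w assume "w \<in> W"
    then obtain c where c: "c \<in> carrier_vec m" "w = L *\<^sub>v c" by (auto simp: W)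
    have "mat_adjoint L *\<^sub>v (x - ?Q *\<^sub>v x) = mat_adjoint L *\<^sub>v x - mat_adjoint L *\<^sub>v (?Q *\<^sub>v x)"
      by (rule mult_minus_distrib_mat_vec[OF La x mult_mat_vec_carrier[OF Q x]])
    also have "mat_adjoint L *\<^sub>v (?Q *\<^sub>v x) = mat_adjoint L *\<^sub>v x"
      by (simp only: assoc_mult_mat_vec[symmetric, OF La Q x] LaQ)
    finally have "mat_adjoint L *\<^sub>v (x - ?Q *\<^sub>v x) = 0\<^sub>v m"
      using mult_mat_vec_carrier[OF La x] by simp
    then show "(x - ?Q *\<^sub>v x) \<bullet>c w = 0"
      using inner[of "x - ?Q *\<^sub>v x" c] x c mult_mat_vec_carrier[OF Q x] by simp
  qed simp
  moreover have "P = ?Q" if P: "?proj P" for P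
  proof -
    have "P *\<^sub>v x = ?Q *\<^sub>v x" if x: "x \<in> carrier_vec k" for x
    proof -
      have Pc: "P \<in> carrier_mat k k" and PW: "P *\<^sub>v x \<in> W"
        and Po: "\<And>w. w \<in> W \<Longrightarrow> (x - P *\<^sub>v x) \<bullet>c w = 0"
        using P x by blast+
      from PW obtain c where c: "c \<in> carrier_vec m" "P *\<^sub>v x = L *\<^sub>v c"
        unfolding W by blast
      have Px: "P *\<^sub>v x \<in> carrier_vec k" by (rule mult_mat_vec_carrier[OF Pc x])
      have orth: "(mat_adjoint L *\<^sub>v (x - P *\<^sub>v x)) \<bullet>c d = 0" if d: "d \<in> carrier_vec m" for d
      proof -
        have "L *\<^sub>v d \<in> W" using d unfolding W by blast
        from Po[OF this] show ?thesis
          using inner[OF minus_carrier_vec[OF x Px] d] by simp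
      qed
      \<comment> \<open>the conjugates of the unit vectors pick out the entries\<close>
      have "mat_adjoint L *\<^sub>v (x - P *\<^sub>v x) = 0\<^sub>v m" (is "?y = _")
      proof (rule eq_vecI)
        fix a assume "a < dim_vec (0\<^sub>v m :: 'a vec)"
        then have a: "a < m" by simp
        have "?y \<bullet> unit_vec m a = 0"
          using orth[OF carrier_vec_conjugate[OF unit_vec_carrier, of m a]]
          by (simp only: conjugate_id)
        then show "?y $ a = 0\<^sub>v m $ a"
          using a scalar_prod_right_unit[OF a, of ?y] by simp
      qed (use carrier_matD[OF L] in simp)
      then have "mat_adjoint L *\<^sub>v x - mat_adjoint L *\<^sub>v (P *\<^sub>v x) = 0\<^sub>v m"
        by (simp only: mult_minus_distrib_mat_vec[OF La x Px])
      moreover have "mat_adjoint L *\<^sub>v (P *\<^sub>v x) = c"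
        using c by (simp add: assoc_mult_mat_vec[symmetric, OF La L] LL)
      ultimately have "mat_adjoint L *\<^sub>v x - c = 0\<^sub>v m" by simp
      then have "mat_adjoint L *\<^sub>v x = c"
        using c mult_mat_vec_carrier[OF La x] carrier_matD[OF L] by (auto simp: vec_eq_iff)
      then show ?thesis
        using c by (simp add: assoc_mult_mat_vec[OF L La x])
    qed
    then have ext: "P *\<^sub>v unit_vec k j = ?Q *\<^sub>v unit_vec k j" for j by simp
    have Pc: "P \<in> carrier_mat k k" using P by blast
    show "P = ?Q"
    proof (rule eq_matI)
      fix i j assume "i < dim_row ?Q" "j < dim_col ?Q"
      then have "i < k" "j < k" using carrier_matD[OF Q] by simp_all
      then show "P $$ (i, j) = ?Q $$ (i, j)"
        using arg_cong[OF ext[of j], of "\<lambda>v. v $ i"] carrier_matD[OF Pc] carrier_matD[OF Q]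
        by (simp del: index_mult_mat(1))
    qed (use carrier_matD[OF Pc] carrier_matD[OF L] in simp_all)
  qed
  ultimately show ?thesis
    unfolding orth_proj_def by (intro the_equality) blast+
qed

section \<open>Independence of the choice of orthonormal bases\<close>

text \<open>The matrix is \<open>V = L\<^sup>*M\<close>. Since \<open>LL\<^sup>* = MM\<^sup>*\<close> is the projection onto \<open>W\<close>, it satisfies
  \<open>L V = MM\<^sup>*M = M\<close>, and the same identity makes it unitary.\<close>

lemma onb_mat_change:
  fixes L :: "'a :: conjugatable_field mat"
  assumes L: "onb_mat k m W L" and M: "onb_mat k m W M"
  shows "\<exists>V. unitary_mat m V \<and> M = L * V"
proof -
  have carr: "L \<in> carrier_mat k m" "M \<in> carrier_mat k m"
    "mat_adjoint L \<in> carrier_mat m k" "mat_adjoint M \<in> carrier_mat m k"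
    and one: "mat_adjoint L * L = 1\<^sub>m m" "mat_adjoint M * M = 1\<^sub>m m"
    using L M by (auto simp: onb_mat_iff)
  note dims = carr(1,2)[THEN carrier_matD(1)] carr(1,2)[THEN carrier_matD(2)]
  have P: "L * mat_adjoint L = M * mat_adjoint M"
    using orth_proj_eq[OF L] orth_proj_eq[OF M] by simp
  define V where "V = mat_adjoint L * M"
  have V: "V \<in> carrier_mat m m" using carr by (auto simp: V_def)
  have LV: "M = L * V"
    unfolding V_def assoc_mult_mat[symmetric, OF carr(1,3,2)] P assoc_mult_mat[OF carr(2,4,2)] one
    by (simp add: right_mult_one_mat[OF carr(2)])
  have "mat_adjoint (mat_adjoint L) = L"
    by (rule eq_matI) auto
  then have Va: "mat_adjoint V = mat_adjoint M * L"
    using mat_adjoint_mult[OF carr(3,2)] by (simp add: V_def)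
  have "mat_adjoint V * V = mat_adjoint M * (L * V)"
    unfolding Va by (rule assoc_mult_mat[OF carr(4,1) V])
  then have 1: "mat_adjoint V * V = 1\<^sub>m m" by (simp add: LV[symmetric] one)
  have "V * mat_adjoint V = mat_adjoint L * (M * mat_adjoint M) * L"
    unfolding Va unfolding V_def 
    by (simp only: mat_mult_assoc_dim dims mat_adjoint_dim index_mult_mat(2,3))
  also have "\<dots> = (mat_adjoint L * L) * (mat_adjoint L * L)"
    by (simp only: P[symmetric] mat_mult_assoc_dim dims mat_adjoint_dim index_mult_mat(2,3))
  finally have "V * mat_adjoint V = 1\<^sub>m m" by (simp add: one)
  with 1 V have "unitary_mat m V" unfolding unitary_mat_def by simp
  then have "unitary_mat m V \<and> M = L * V" using LV by (rule conjI)
  then show ?thesis by (rule exI)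
qed

lemma cross_gram_carrier:
  "L \<in> carrier_mat k m \<Longrightarrow> cross_gram L M \<in> carrier_mat m m"
  by (intro carrier_matI) (simp_all add: cross_gram_def)

lemma cross_gram_mult_right_unitary:
  fixes L M :: "'a :: conjugatable_field mat"
  assumes L: "L \<in> carrier_mat k m" and M: "M \<in> carrier_mat k m"
    and V: "V \<in> carrier_mat m m" and X: "unitary_mat m X"
  shows "cross_gram (L * V) (M * X) = mat_adjoint V * cross_gram L M * V"
proof -
  have X': "X \<in> carrier_mat m m" "X * mat_adjoint X = 1\<^sub>m m"
    using X by (auto simp: unitary_mat_def)
  note dims = carrier_matD[OF L] carrier_matD[OF M] carrier_matD[OF V] carrier_matD[OF X'(1)]
  have XX: "X * (mat_adjoint X * B) = B" if "dim_row B = m" for B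
  proof -
    have B: "B \<in> carrier_mat m (dim_col B)" using that by (intro carrier_matI) simp_all
    show ?thesis
      by (simp only: assoc_mult_mat[symmetric, OF X'(1) mat_adjoint_carrier[OF X'(1)] B]
          X'(2) left_mult_one_mat[OF B])
  qed
  show ?thesis
    unfolding cross_gram_def mat_adjoint_mult[OF L V] mat_adjoint_mult[OF M X'(1)]
    by (simp only: mat_mult_assoc_dim XX dims mat_adjoint_dim index_mult_mat(2,3))
qed

text \<open>
  Replacing the orthonormal bases conjugates every cross Gram matrix by a unitary matrix, so a
  property of cross Gram matrices that is invariant under such a conjugation may be tested on any
  one choice of bases. This is what lets the three notions that are defined by the existence of
  bases be evaluated on a prescribed one.
\<close>

lemma cross_gram_choice:
  fixes L :: "nat \<Rightarrow> 'a :: conjugatable_field mat"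
  assumes L: "\<forall>i<n. onb_mat k m (W i) (L i)"
    and inv: "\<And>c G V. G \<in> carrier_mat m m \<Longrightarrow> unitary_mat m V \<Longrightarrow>
      R c (mat_adjoint V * G * V) \<longleftrightarrow> R c G"
  shows "(\<exists>L. (\<forall>i<n. onb_mat k m (W i) (L i)) \<and>
       (\<exists>c. Q c \<and> (\<forall>i<n. \<forall>j<n. i \<noteq> j \<longrightarrow> R c (cross_gram (L i) (L j))))) \<longleftrightarrow>
     (\<exists>c. Q c \<and> (\<forall>i<n. \<forall>j<n. i \<noteq> j \<longrightarrow> R c (cross_gram (L i) (L j))))"
proof -
  have eq: "R c (cross_gram (M i) (M j)) \<longleftrightarrow> R c (cross_gram (L i) (L j))"
    if M: "\<forall>i<n. onb_mat k m (W i) (M i)" and i: "i < n" and j: "j < n" for M i j c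
  proof -
    have Lij: "L i \<in> carrier_mat k m" "L j \<in> carrier_mat k m"
      using L i j by (auto simp: onb_mat_iff)
    obtain V where V: "unitary_mat m V" "M i = L i * V"
      using onb_mat_change L M i by blast
    obtain X where X: "unitary_mat m X" "M j = L j * X"
      using onb_mat_change L M j by blast
    have "V \<in> carrier_mat m m" using V by (simp add: unitary_mat_def)
    then show ?thesis
      using inv[OF cross_gram_carrier[OF Lij(1)] V(1)]
      by (simp add: V X(2) cross_gram_mult_right_unitary[OF Lij _ X(1)])
  qed
  show ?thesis (is "?some \<longleftrightarrow> ?given")
  proof
    assume ?some
    then obtain M c where M: "\<forall>i<n. onb_mat k m (W i) (M i)" and "Q c"
      and "\<forall>i<n. \<forall>j<n. i \<noteq> j \<longrightarrow> R c (cross_gram (M i) (M j))"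
      by blast
    then show ?given
      using eq[OF M] by auto
  next
    assume ?given
    with L show ?some by blast
  qed
qed

lemma unitary_conj_undo:
  assumes G: "G \<in> carrier_mat m m" and V: "unitary_mat m V"
  shows "V * (mat_adjoint V * G * V) * mat_adjoint V = (G :: 'a :: conjugatable_field mat)"
proof -
  have V': "V \<in> carrier_mat m m" "mat_adjoint V \<in> carrier_mat m m" "V * mat_adjoint V = 1\<^sub>m m"
    using V by (auto simp: unitary_mat_def)
  have "V * (mat_adjoint V * G * V) * mat_adjoint V = (V * mat_adjoint V) * (G * (V * mat_adjoint V))"
    by (simp only: mat_mult_assoc_dim carrier_matD[OF G] carrier_matD[OF V'(1)] mat_adjoint_dim
        index_mult_mat(2,3))
  then show ?thesis
    using G by (simp add: V'(3))
qed

lemma mat_trace_unitary_conj: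
  assumes G: "G \<in> carrier_mat m m" and V: "unitary_mat m V"
  shows "mat_trace (mat_adjoint V * G * V) = mat_trace (G :: 'a :: conjugatable_field mat)"
proof -
  have V': "V \<in> carrier_mat m m" "mat_adjoint V \<in> carrier_mat m m" "V * mat_adjoint V = 1\<^sub>m m"
    using V by (auto simp: unitary_mat_def)
  have "mat_trace (mat_adjoint V * G * V) = mat_trace (V * (mat_adjoint V * G))"
    by (rule mat_trace_comm[OF mult_carrier_mat[OF V'(2) G] V'(1)])
  also have "V * (mat_adjoint V * G) = G"
    using G by (simp add: assoc_mult_mat[symmetric, OF V'(1,2) G] V'(3))
  finally show ?thesis .
qed

lemma char_poly_unitary_conj:
  assumes G: "G \<in> carrier_mat m m" and V: "unitary_mat m V"
  shows "char_poly (mat_adjoint V * G * V) = char_poly (G :: 'a :: conjugatable_field mat)"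
proof -
  have V': "V \<in> carrier_mat m m" "mat_adjoint V \<in> carrier_mat m m"
    "V * mat_adjoint V = 1\<^sub>m m" "mat_adjoint V * V = 1\<^sub>m m"
    using V by (auto simp: unitary_mat_def)
  have "similar_mat (mat_adjoint V * G * V) G"
    by (rule similar_matI[of _ _ "mat_adjoint V" V m])
      (use G V' mult_carrier_mat[OF mult_carrier_mat[OF V'(2) G] V'(1)] in simp_all)
  then show ?thesis by (rule char_poly_similar)
qed

lemma scalar_mat_unitary_conj:
  fixes G :: "'a :: conjugatable_field mat"
  assumes G: "G \<in> carrier_mat m m" and V: "unitary_mat m V"
  shows "mat_adjoint V * G * V = c \<cdot>\<^sub>m 1\<^sub>m m \<longleftrightarrow> G = c \<cdot>\<^sub>m 1\<^sub>m m"
proof -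
  have V': "V \<in> carrier_mat m m" "mat_adjoint V \<in> carrier_mat m m"
    "V * mat_adjoint V = 1\<^sub>m m" "mat_adjoint V * V = 1\<^sub>m m"
    using V by (auto simp: unitary_mat_def)
  have scal: "X * (c \<cdot>\<^sub>m 1\<^sub>m m) * Y = c \<cdot>\<^sub>m (X * Y)"
    if "X \<in> carrier_mat m m" "Y \<in> carrier_mat m m" for X Y :: "'a mat"
    using that by (simp add: mult_smult_distrib[OF that(1) one_carrier_mat]
      mult_smult_assoc_mat[OF that])
  show ?thesis
    using unitary_conj_undo[OF G V] scal[OF V'(1,2)] scal[OF V'(2,1)] V'(3,4) by metis
qed

lemma equichordal_iff:
  assumes "\<forall>i<n. onb_mat k m (W i) (L i)"
  shows "equichordal k m n W \<longleftrightarrow>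
    (\<exists>c. \<forall>i<n. \<forall>j<n. i \<noteq> j \<longrightarrow> mat_trace (cross_gram (L i) (L j)) = c)"
  using cross_gram_choice[OF assms, of "\<lambda>c G. mat_trace G = c" "\<lambda>_. True"]
  by (simp add: equichordal_def mat_trace_unitary_conj)

lemma strongly_simplicial_iff:
  assumes "\<forall>i<n. onb_mat k m (W i) (L i)"
  shows "strongly_simplicial k m n W \<longleftrightarrow>
    (\<exists>E. \<forall>i<n. \<forall>j<n. i \<noteq> j \<longrightarrow> proots (char_poly (cross_gram (L i) (L j))) = E)"
  using cross_gram_choice[OF assms, of "\<lambda>E G. proots (char_poly G) = E" "\<lambda>_. True"]
  by (simp add: strongly_simplicial_def char_poly_unitary_conj)

lemma equiisoclinic_iff:
  assumes "\<forall>i<n. onb_mat k m (W i) (L i)"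
  shows "equiisoclinic k m n W \<longleftrightarrow>
    (\<exists>\<alpha>::real. \<alpha> \<ge> 0 \<and>
      (\<forall>i<n. \<forall>j<n. i \<noteq> j \<longrightarrow> cross_gram (L i) (L j) = of_real \<alpha> \<cdot>\<^sub>m 1\<^sub>m m))"
  using cross_gram_choice[OF assms, of "\<lambda>\<alpha> G. G = of_real \<alpha> \<cdot>\<^sub>m 1\<^sub>m m" "\<lambda>\<alpha>::real. \<alpha> \<ge> 0"]
  by (simp add: equiisoclinic_def scalar_mat_unitary_conj)

section \<open>Twisting a subspace by a unitary matrix\<close>

lemma block_row_kronecker:
  assumes B: "\<And>j. j < m \<Longrightarrow> B j = kronecker (mat_of_cols k [v j]) U"
    and U: "U \<in> carrier_mat r r"
  shows "block_row (r * k) r m B = kronecker (mat k m (\<lambda>(p, j). v j $ p)) U"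
proof (rule eq_matI)
  fix a b assume "a < dim_row (kronecker (mat k m (\<lambda>(p, j). v j $ p)) U)"
    "b < dim_col (kronecker (mat k m (\<lambda>(p, j). v j $ p)) U)"
  with U have ab: "a < k * r" "b < m * r" by auto
  note dm = div_mod_less_prod[OF ab(1)] div_mod_less_prod[OF ab(2)]
  have "block_row (r * k) r m B $$ (a, b)
      = kronecker (mat_of_cols k [v (b div r)]) U $$ (a, b mod r)"
    using ab B[OF dm(3)] by (simp add: block_row_def mult.commute)
  also have "\<dots> = v (b div r) $ (a div r) * U $$ (a mod r, b mod r)"
    using ab dm U by (simp add: kronecker_def mat_of_cols_def)
  also have "\<dots> = kronecker (mat k m (\<lambda>(p, j). v j $ p)) U $$ (a, b)"
    using ab dm U by (simp add: kronecker_def)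
  finally show "block_row (r * k) r m B $$ (a, b)
      = kronecker (mat k m (\<lambda>(p, j). v j $ p)) U $$ (a, b)" .
qed (use U in \<open>auto simp: block_row_def\<close>)

lemma orthonormal_basis_imp_onb_mat:
  assumes "orthonormal_basis k m W v"
  shows "onb_mat k m W (mat k m (\<lambda>(p, j). v j $ p))" (is "onb_mat k m W ?L")
proof -
  have col: "col ?L j = v j" if "j < m" for j
    using assms that by (intro eq_vecI) (auto simp: orthonormal_basis_def orthonormal_family_def)
  then have "col ?L ` {..<m} = v ` {..<m}" by auto
  then show ?thesis
    using assms col by (simp add: onb_mat_def orthonormal_basis_def orthonormal_family_def)
qed

lemma onb_mat_kronecker:
  fixes L :: "'a :: conjugatable_field mat"
  assumes L: "onb_mat k m W L" and U: "unitary_mat r U"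
  shows "onb_mat (r * k) (r * m) (vec_space.col_space (r * k) (kronecker L U)) (kronecker L U)"
proof (rule onb_mat_col_space)
  have carr: "L \<in> carrier_mat k m" "mat_adjoint L \<in> carrier_mat m k"
    "U \<in> carrier_mat r r" "mat_adjoint U \<in> carrier_mat r r"
    and one: "mat_adjoint L * L = 1\<^sub>m m" "mat_adjoint U * U = 1\<^sub>m r"
    using L U by (auto simp: onb_mat_iff unitary_mat_def)
  show "kronecker L U \<in> carrier_mat (r * k) (r * m)"
    using kronecker_carrier[OF carr(1,3)] by (simp add: mult.commute)
  show "mat_adjoint (kronecker L U) * kronecker L U = 1\<^sub>m (r * m)"
    unfolding mat_adjoint_kronecker kronecker_mult[OF carr(2,4,1,3)] one kronecker_one_one
    by (simp add: mult.commute)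
qed

lemma orth_proj_kronecker:
  fixes L :: "'a :: conjugatable_field mat"
  assumes L: "onb_mat k m W L" and U: "unitary_mat r U"
    and LU: "onb_mat (r * k) (r * m) Wbar (kronecker L U)"
  shows "orth_proj (r * k) Wbar = kronecker (orth_proj k W) (1\<^sub>m r)"
proof -
  have carr: "L \<in> carrier_mat k m" "mat_adjoint L \<in> carrier_mat m k"
    "U \<in> carrier_mat r r" "mat_adjoint U \<in> carrier_mat r r"
    and one: "U * mat_adjoint U = 1\<^sub>m r"
    using L U by (auto simp: onb_mat_iff unitary_mat_def)
  show ?thesis
    unfolding orth_proj_eq[OF L] orth_proj_eq[OF LU] mat_adjoint_kronecker
      kronecker_mult[OF carr(1,3,2,4)] one ..
qed

lemma orth_proj_carrier:
  "onb_mat k m W L \<Longrightarrow> orth_proj k W \<in> carrier_mat k k"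
  using orth_proj_eq[of k m W L] by (auto simp: onb_mat_iff intro!: mult_carrier_mat[of _ k m _ k])

text \<open>
  The factor contributed by the two unitary matrices is \<open>U\<^sup>* V V\<^sup>* U = I\<close>, whatever they are; this
  is why the twists may differ from one subspace to the next.
\<close>

lemma cross_gram_kronecker:
  fixes L M :: "'a :: conjugatable_field mat"
  assumes L: "L \<in> carrier_mat k m" and M: "M \<in> carrier_mat k m"
    and U: "unitary_mat r U" and V: "unitary_mat r V"
  shows "cross_gram (kronecker L U) (kronecker M V) = kronecker (cross_gram L M) (1\<^sub>m r)"
proof -
  have La: "mat_adjoint L \<in> carrier_mat m k" "mat_adjoint M \<in> carrier_mat m k"
    using L M by auto
  have Uc: "U \<in> carrier_mat r r" "V \<in> carrier_mat r r"
    "mat_adjoint U \<in> carrier_mat r r" "mat_adjoint V \<in> carrier_mat r r"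
    and one: "V * mat_adjoint V = 1\<^sub>m r" "mat_adjoint U * U = 1\<^sub>m r"
    using U V by (auto simp: unitary_mat_def)
  have c: "mat_adjoint L * M \<in> carrier_mat m m" "mat_adjoint L * M * mat_adjoint M \<in> carrier_mat m k"
    "mat_adjoint U * V \<in> carrier_mat r r" "mat_adjoint U * V * mat_adjoint V \<in> carrier_mat r r"
    using L M La Uc by (auto intro: mult_carrier_mat)
  have "mat_adjoint U * V * mat_adjoint V * U = 1\<^sub>m r"
    using Uc by (simp add: assoc_mult_mat[OF Uc(3,2,4)] one)
  then show ?thesis
    unfolding cross_gram_def mat_adjoint_kronecker
      kronecker_mult[OF La(1) Uc(3) M Uc(2)] kronecker_mult[OF c(1,3) La(2) Uc(4)]
      kronecker_mult[OF c(2,4) L Uc(1)] by simp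
qed

section \<open>Chordal distances and the orthoplex bound\<close>

lemma cplx_of_nat_mult: "cplx (of_nat r * x :: 'a :: real_or_complex) = of_nat r * cplx x"
  using cplx_scaleR[of "real r" x] by (simp add: scaleR_conv_of_real)

text \<open>
  The equation also holds where the radicand is negative, since \<open>sqrt\<close> is odd and multiplicative on
  the whole real line.
\<close>

lemma chordal_dist_scale:
  fixes V W Vbar Wbar :: "'a :: real_or_complex vec set"
  assumes V: "orth_proj k V \<in> carrier_mat k k" and W: "orth_proj k W \<in> carrier_mat k k"
    and "orth_proj (r * k) Vbar = kronecker (orth_proj k V) (1\<^sub>m r)"
    and "orth_proj (r * k) Wbar = kronecker (orth_proj k W) (1\<^sub>m r)"
  shows "(chordal_dist (r * k) (r * m) Vbar Wbar)\<^sup>2 = real r * (chordal_dist k m V W)\<^sup>2"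
proof -
  have "mat_trace (orth_proj (r * k) Vbar * orth_proj (r * k) Wbar)
      = of_nat r * mat_trace (orth_proj k V * orth_proj k W)"
    by (simp add: assms(3,4) kronecker_mult[OF V one_carrier_mat W one_carrier_mat]
        mat_trace_kronecker_one[OF mult_carrier_mat[OF V W]])
  then have "chordal_dist (r * k) (r * m) Vbar Wbar = sqrt (real r) * chordal_dist k m V W"
    by (simp add: chordal_dist_def cplx_of_nat_mult real_sqrt_mult[symmetric] algebra_simps)
  then show ?thesis
    by (simp add: power_mult_distrib)
qed

lemma saturates_orthoplex_scale:
  fixes W Wbar :: "nat \<Rightarrow> 'a :: real_or_complex vec set"
  assumes r: "0 < r"
    and d: "\<And>i j. i < n \<Longrightarrow> j < n \<Longrightarrow>
      (chordal_dist (r * k) (r * m) (Wbar i) (Wbar j))\<^sup>2 = real r * (chordal_dist k m (W i) (W j))\<^sup>2"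
  shows "saturates_orthoplex (r * k) (r * m) n Wbar \<longleftrightarrow> saturates_orthoplex k m n W"
proof (cases "n \<ge> 2")
  case True
  define S where "S = {(chordal_dist k m (W i) (W j))\<^sup>2 | i j. i < n \<and> j < n \<and> i \<noteq> j}"
  have "S = (\<lambda>(i, j). (chordal_dist k m (W i) (W j))\<^sup>2) ` {(i, j). i < n \<and> j < n \<and> i \<noteq> j}"
    by (auto simp: S_def)
  moreover have "finite {(i, j). i < n \<and> j < n \<and> i \<noteq> j}"
    by (rule finite_subset[of _ "{..<n} \<times> {..<n}"]) auto
  ultimately have "finite S" by simp
  moreover have "S \<noteq> {}"
  proof -
    have "(chordal_dist k m (W 0) (W 1))\<^sup>2 \<in> S"
      unfolding S_def using True by (intro CollectI exI[of _ 0] exI[of _ 1]) auto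
    then show ?thesis by blast
  qed
  moreover have "mono ((*) (real r))"
    by (auto intro!: monoI mult_left_mono)
  ultimately have "real r * Min S = Min ((*) (real r) ` S)"
    by (rule mono_Min_commute[rotated 1])
  also have "(*) (real r) ` S = {real r * (chordal_dist k m (W i) (W j))\<^sup>2 | i j.
      i < n \<and> j < n \<and> i \<noteq> j}"
    unfolding S_def by blast
  also have "\<dots> = {(chordal_dist (r * k) (r * m) (Wbar i) (Wbar j))\<^sup>2 | i j. i < n \<and> j < n \<and> i \<noteq> j}"
    by (intro Collect_cong ex_cong1) (auto simp: d)
  finally have Min: "Min {(chordal_dist (r * k) (r * m) (Wbar i) (Wbar j))\<^sup>2 | i j.
      i < n \<and> j < n \<and> i \<noteq> j} = real r * Min S" ..
  have "real (r * m) * (real (r * k) - real (r * m)) / real (r * k)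
      = (real r * (real r * (real m * (real k - real m)))) / (real r * real k)"
    by (simp add: algebra_simps)
  also have "\<dots> = real r * (real m * (real k - real m) / real k)"
    using r by simp
  finally have rhs: "real (r * m) * (real (r * k) - real (r * m)) / real (r * k)
      = real r * (real m * (real k - real m) / real k)" .
  have cancel: "real r * Min S = real r * t \<longleftrightarrow> Min S = t" for t
    using r by simp
  show ?thesis
    unfolding saturates_orthoplex_def Min S_def[symmetric] rhs cancel ..
qed (simp add: saturates_orthoplex_def)

text \<open>The space of Hermitian matrices grows so fast with the size that the two admissible ranges
  for the number of subspaces are disjoint.\<close>

lemma zdim_growth:
  assumes "2 \<le> r"
  shows "2 * (zdim TYPE('a :: real_or_complex) k - 1) \<le> zdim TYPE('a) (r * k)"
proof (cases "range (cplx :: 'a \<Rightarrow> complex) = UNIV")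
  case True
  have "2 * k\<^sup>2 \<le> r\<^sup>2 * k\<^sup>2"
    using assms self_le_power[of r 2] by (intro mult_right_mono) auto
  then have "2 * (k\<^sup>2 - 1) \<le> (r * k)\<^sup>2"
    unfolding power_mult_distrib by linarith
  with True show ?thesis
    by (simp add: zdim_def)
next
  case False
  have "2 * (k * (k + 1) div 2) \<le> k * (k + 1)"
    by simp
  also have "\<dots> \<le> k * (2 * k + 1)"
    by simp
  also have "\<dots> = (2 * k) * (2 * k + 1) div 2"
    by simp
  also have "\<dots> \<le> (r * k) * (r * k + 1) div 2"
    using assms by (intro div_le_mono mult_mono add_mono) auto
  finally show ?thesis
    using False by (simp add: zdim_def)
qed

section \<open>Tight fusion frames\<close>

text \<open>The frame identity at a unit vector gives a column of the matrix identity
  \<open>P\<^sub>0 + \<dots> + P\<^sub>n\<^sub>-\<^sub>1 = A I\<close>; this identity in turn gives the one at every vector. The entrywise form is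
  the one that the Kronecker product respects.\<close>

lemma fusion_frame_bound_iff:
  fixes W :: "nat \<Rightarrow> 'a :: real_or_complex vec set"
  assumes P: "\<And>i. i < n \<Longrightarrow> orth_proj k (W i) \<in> carrier_mat k k"
  shows "fusion_frame_bound k n W A \<longleftrightarrow> A > 0 \<and>
    (\<forall>p<k. \<forall>q<k. (\<Sum>i<n. orth_proj k (W i) $$ (p, q)) = (if p = q then of_real A else 0))"
proof (cases "A > 0")
  case True
  define S where "S p q = (\<Sum>i<n. orth_proj k (W i) $$ (p, q))" for p q
  let ?F = "\<lambda>x. finsum_vec TYPE('a) k (\<lambda>i. orth_proj k (W i) *\<^sub>v x) {..<n}"
  have Px: "(\<lambda>i. orth_proj k (W i) *\<^sub>v x) \<in> {..<n} \<rightarrow> carrier_vec k" if "x \<in> carrier_vec k" for x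
    using P that by (auto intro!: mult_mat_vec_carrier)
  have F: "?F x \<in> carrier_vec k" if "x \<in> carrier_vec k" for x
    using finsum_vec_closed[OF Px[OF that]] .
  have entry: "?F x $ p = (\<Sum>q<k. S p q * x $ q)" if x: "x \<in> carrier_vec k" and p: "p < k" for x p
  proof -
    have "?F x $ p = (\<Sum>i<n. (orth_proj k (W i) *\<^sub>v x) $ p)"
      by (rule index_finsum_vec[OF finite_lessThan p Px[OF x]])
    also have "\<dots> = (\<Sum>i<n. \<Sum>q<k. orth_proj k (W i) $$ (p, q) * x $ q)"
    proof (rule sum.cong[OF refl])
      fix i assume "i \<in> {..<n}"
      then have "orth_proj k (W i) \<in> carrier_mat k k" using P by simp
      from carrier_matD[OF this]
      show "(orth_proj k (W i) *\<^sub>v x) $ p = (\<Sum>q<k. orth_proj k (W i) $$ (p, q) * x $ q)"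
        using x p by (simp add: scalar_prod_def atLeast0LessThan cong: sum.cong_simp)
    qed
    also have "\<dots> = (\<Sum>q<k. S p q * x $ q)"
      by (subst sum.swap) (simp add: S_def sum_distrib_right)
    finally show ?thesis .
  qed
  have A: "(of_real A :: 'a) \<noteq> 0" "of_real (1 / A) = 1 / (of_real A :: 'a)"
    using True by auto
  have "(\<forall>x\<in>carrier_vec k. x = of_real (1 / A) \<cdot>\<^sub>v ?F x) \<longleftrightarrow>
      (\<forall>x\<in>carrier_vec k. \<forall>p<k. of_real A * x $ p = (\<Sum>q<k. S p q * x $ q))"
  proof (rule ball_cong[OF refl])
    fix x :: "'a vec" assume x: "x \<in> carrier_vec k"
    have "x = of_real (1 / A) \<cdot>\<^sub>v ?F x \<longleftrightarrow> (\<forall>p<k. x $ p = of_real (1 / A) * ?F x $ p)"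
      using x carrier_vecD[OF F[OF x]] by (auto simp: vec_eq_iff simp del: finsum_vec_empty)
    also have "\<dots> \<longleftrightarrow> (\<forall>p<k. of_real A * x $ p = (\<Sum>q<k. S p q * x $ q))"
      using A entry[OF x] by (auto simp: field_simps)
    finally show "x = of_real (1 / A) \<cdot>\<^sub>v ?F x \<longleftrightarrow>
      (\<forall>p<k. of_real A * x $ p = (\<Sum>q<k. S p q * x $ q))" .
  qed
  also have "\<dots> \<longleftrightarrow> (\<forall>p<k. \<forall>q<k. S p q = (if p = q then of_real A else 0))"
  proof (intro iffI allI impI ballI)
    fix p q
    assume *: "\<forall>x\<in>carrier_vec k. \<forall>p<k. of_real A * x $ p = (\<Sum>q<k. S p q * x $ q)"
      and pq: "p < k" "q < k"
    have "of_real A * unit_vec k q $ p = (\<Sum>l<k. S p l * unit_vec k q $ l)"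
      using * pq(1) unit_vec_carrier by blast
    also have "\<dots> = (\<Sum>l<k. if l = q then S p l else 0)"
      using pq by (intro sum.cong) auto
    also have "\<dots> = S p q"
      using pq by simp
    finally show "S p q = (if p = q then of_real A else 0)"
      unfolding index_unit_vec(1)[OF pq(2,1)] by (simp split: if_splits)
  next
    fix x :: "'a vec" and p
    assume *: "\<forall>p<k. \<forall>q<k. S p q = (if p = q then of_real A else 0)" and p: "p < k"
    have "(\<Sum>q<k. S p q * x $ q) = (\<Sum>q<k. if q = p then of_real A * x $ q else 0)"
      using * p by (intro sum.cong) auto
    then show "of_real A * x $ p = (\<Sum>q<k. S p q * x $ q)"
      using p by simp
  qed
  finally show ?thesis
    using True by (simp add: fusion_frame_bound_def S_def)
qed (simp add: fusion_frame_bound_def)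

lemma fusion_frame_bound_unique:
  fixes W :: "nat \<Rightarrow> 'a :: real_or_complex vec set"
  assumes P: "\<And>i. i < n \<Longrightarrow> orth_proj k (W i) \<in> carrier_mat k k" and "0 < k"
    and "fusion_frame_bound k n W A" "fusion_frame_bound k n W B"
  shows "A = B"
proof -
  have "(of_real C :: 'a) = (\<Sum>i<n. orth_proj k (W i) $$ (0, 0))"
    if "fusion_frame_bound k n W C" for C
    using that \<open>0 < k\<close> by (simp add: fusion_frame_bound_iff[OF P])
  from this[OF assms(3)] this[OF assms(4)] have "(of_real A :: 'a) = of_real B"
    by simp
  then show ?thesis by simp
qed

text \<open>In the entries of \<open>\<Sum>P\<^sub>i \<otimes> I\<close> those with \<open>a mod r \<noteq> b mod r\<close> vanish and the others repeat the entries
  of \<open>\<Sum>P\<^sub>i\<close>, so one of the two sums is \<open>A I\<close> exactly when the other is.\<close>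

lemma fusion_frame_bound_kronecker:
  fixes W Wbar :: "nat \<Rightarrow> 'a :: real_or_complex vec set"
  assumes P: "\<And>i. i < n \<Longrightarrow> orth_proj k (W i) \<in> carrier_mat k k"
    and Pbar: "\<And>i. i < n \<Longrightarrow> orth_proj (r * k) (Wbar i) = kronecker (orth_proj k (W i)) (1\<^sub>m r)"
    and r: "0 < r"
  shows "fusion_frame_bound (r * k) n Wbar A \<longleftrightarrow> fusion_frame_bound k n W A"
proof -
  have Pbar_carrier: "orth_proj (r * k) (Wbar i) \<in> carrier_mat (r * k) (r * k)" if "i < n" for i
    using kronecker_carrier[OF P[OF that] one_carrier_mat, of r] Pbar[OF that]
    by (simp add: mult.commute)
  have entry: "(\<Sum>i<n. orth_proj (r * k) (Wbar i) $$ (a, b)) =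
      (if a mod r = b mod r then \<Sum>i<n. orth_proj k (W i) $$ (a div r, b div r) else 0)"
    if ab: "a < r * k" "b < r * k" for a b
  proof -
    have ab': "a < k * r" "b < k * r" using ab by (auto simp: mult.commute)
    have "orth_proj (r * k) (Wbar i) $$ (a, b) =
        (if a mod r = b mod r then orth_proj k (W i) $$ (a div r, b div r) else 0)" if "i < n" for i
      unfolding Pbar[OF that] kronecker_index[OF P[OF that] one_carrier_mat ab']
      using r by simp
    then show ?thesis by simp
  qed
  have "(\<forall>a<r * k. \<forall>b<r * k. (\<Sum>i<n. orth_proj (r * k) (Wbar i) $$ (a, b))
        = (if a = b then of_real A else 0)) \<longleftrightarrow>
      (\<forall>p<k. \<forall>q<k. (\<Sum>i<n. orth_proj k (W i) $$ (p, q)) = (if p = q then of_real A else 0))"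
    (is "?bar \<longleftrightarrow> ?orig")
  proof (intro iffI allI impI)
    fix p q assume bar: ?bar and pq: "p < k" "q < k"
    have lt: "p * r < r * k" "q * r < r * k"
      using pq r by (auto simp: mult.commute)
    with bar have "(\<Sum>i<n. orth_proj (r * k) (Wbar i) $$ (p * r, q * r))
        = (if p * r = q * r then of_real A else 0)" by blast
    then show "(\<Sum>i<n. orth_proj k (W i) $$ (p, q)) = (if p = q then of_real A else 0)"
      using r unfolding entry[OF lt] by simp
  next
    fix a b assume orig: ?orig and ab: "a < r * k" "b < r * k"
    have "a div r < k" "b div r < k"
      using ab by (auto intro!: less_mult_imp_div_less simp: mult.commute)
    moreover have "a = b \<longleftrightarrow> a div r = b div r \<and> a mod r = b mod r"
      by (metis div_mult_mod_eq)
    ultimately show "(\<Sum>i<n. orth_proj (r * k) (Wbar i) $$ (a, b)) = (if a = b then of_real A else 0)"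
      unfolding entry[OF ab] using orig by simp
  qed
  then show ?thesis
    by (simp add: fusion_frame_bound_iff[OF P] fusion_frame_bound_iff[OF Pbar_carrier])
qed

section \<open>Properties of the twisted collection\<close>

lemma constant_inj_iff:
  fixes n :: nat
  assumes "inj h"
  shows "(\<exists>c. \<forall>i<n. \<forall>j<n. i \<noteq> j \<longrightarrow> h (f i j) = c) \<longleftrightarrow> (\<exists>c. \<forall>i<n. \<forall>j<n. i \<noteq> j \<longrightarrow> f i j = c)"
proof
  assume "\<exists>c. \<forall>i<n. \<forall>j<n. i \<noteq> j \<longrightarrow> h (f i j) = c"
  then obtain c where "\<forall>i<n. \<forall>j<n. i \<noteq> j \<longrightarrow> h (f i j) = c" ..
  then have "\<forall>i<n. \<forall>j<n. i \<noteq> j \<longrightarrow> f i j = inv_into UNIV h c"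
    using inv_f_f[OF assms] by metis
  then show "\<exists>c. \<forall>i<n. \<forall>j<n. i \<noteq> j \<longrightarrow> f i j = c" ..
next
  assume "\<exists>c. \<forall>i<n. \<forall>j<n. i \<noteq> j \<longrightarrow> f i j = c"
  then obtain c where "\<forall>i<n. \<forall>j<n. i \<noteq> j \<longrightarrow> f i j = c" ..
  then have "\<forall>i<n. \<forall>j<n. i \<noteq> j \<longrightarrow> h (f i j) = h c" by simp
  then show "\<exists>c. \<forall>i<n. \<forall>j<n. i \<noteq> j \<longrightarrow> h (f i j) = c" ..
qed

theorem theorem2p2:
  fixes k m n r :: nat
    and W Wbar :: "nat \<Rightarrow> 'a :: real_or_complex vec set"
    and e :: "nat \<Rightarrow> nat \<Rightarrow> 'a vec"
    and U Lbar :: "nat \<Rightarrow> 'a mat"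
    and ebar :: "nat \<Rightarrow> nat \<Rightarrow> 'a mat"
  assumes m: "1 \<le> m" "m \<le> k - 1"
    and r: "1 \<le> r"
    and W: "\<And>i. i < n \<Longrightarrow> W i \<in> Gr k m"
    and e: "\<And>i. i < n \<Longrightarrow> orthonormal_basis k m (W i) (e i)"
    and U: "\<And>i. i < n \<Longrightarrow> unitary_mat r (U i)"
    and ebar: "\<And>i j. i < n \<Longrightarrow> j < m \<Longrightarrow> ebar i j = kronecker (mat_of_cols k [e i j]) (U i)"
    and Lbar: "\<And>i. i < n \<Longrightarrow> Lbar i = block_row (r * k) r m (ebar i)"
    and Wbar: "\<And>i. i < n \<Longrightarrow> Wbar i = vec_space.col_space (r * k) (Lbar i)"
  shows
    "(\<forall>i<n. Lbar i \<in> carrier_mat (r * k) (r * m) \<and>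
            orthonormal_family (r * k) (r * m) (col (Lbar i)) \<and>
            Wbar i \<in> Gr (r * k) (r * m)) \<and>
     (equichordal (r * k) (r * m) n Wbar \<longleftrightarrow> equichordal k m n W) \<and>
     (strongly_simplicial (r * k) (r * m) n Wbar \<longleftrightarrow> strongly_simplicial k m n W) \<and>
     (equiisoclinic (r * k) (r * m) n Wbar \<longleftrightarrow> equiisoclinic k m n W) \<and>
     (saturates_orthoplex (r * k) (r * m) n Wbar \<longleftrightarrow> saturates_orthoplex k m n W) \<and>
     (r \<ge> 2 \<longrightarrow> \<not> (orthoplectic_packing (r * k) (r * m) n Wbar \<and> orthoplectic_packing k m n W)) \<and>
     (tight_fusion_frame (r * k) n Wbar \<longleftrightarrow> tight_fusion_frame k n W) \<and>
     (\<forall>A B. fusion_frame_bound k n W A \<and> fusion_frame_bound (r * k) n Wbar B \<longrightarrow> A = B)"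
proof -
  from r have r0: "0 < r" by simp
  define L where "L i = mat k m (\<lambda>(p, j). e i j $ p)" for i
  have L: "onb_mat k m (W i) (L i)" if "i < n" for i
    unfolding L_def by (rule orthonormal_basis_imp_onb_mat[OF e[OF that]])
  have Lc: "L i \<in> carrier_mat k m" if "i < n" for i
    using L[OF that] by (simp add: onb_mat_def)
  have Lb: "Lbar i = kronecker (L i) (U i)" if "i < n" for i
    unfolding Lbar[OF that] L_def
    by (rule block_row_kronecker) (use ebar U that in \<open>auto simp: unitary_mat_def\<close>)
  have LU: "onb_mat (r * k) (r * m) (Wbar i) (kronecker (L i) (U i))" if "i < n" for i
    unfolding Wbar[OF that] Lb[OF that] by (rule onb_mat_kronecker[OF L[OF that] U[OF that]])
  have onb: "\<forall>i<n. onb_mat k m (W i) (L i)"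
    "\<forall>i<n. onb_mat (r * k) (r * m) (Wbar i) (kronecker (L i) (U i))"
    using L LU by auto
  have P: "orth_proj k (W i) \<in> carrier_mat k k" if "i < n" for i
    by (rule orth_proj_carrier[OF L[OF that]])
  have Pbar: "orth_proj (r * k) (Wbar i) = kronecker (orth_proj k (W i)) (1\<^sub>m r)" if "i < n" for i
    by (rule orth_proj_kronecker[OF L[OF that] U[OF that] LU[OF that]])
  let ?G = "\<lambda>i j. cross_gram (L i) (L j)"
  have Gc: "?G i j \<in> carrier_mat m m" if "i < n" for i j
    by (rule cross_gram_carrier[OF Lc[OF that]])
  have G: "cross_gram (kronecker (L i) (U i)) (kronecker (L j) (U j)) = kronecker (?G i j) (1\<^sub>m r)"
    if "i < n" "j < n" for i j
    by (rule cross_gram_kronecker[OF Lc Lc U U]) (use that in simp_all)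

  have 1: "\<forall>i<n. Lbar i \<in> carrier_mat (r * k) (r * m) \<and>
      orthonormal_family (r * k) (r * m) (col (Lbar i)) \<and> Wbar i \<in> Gr (r * k) (r * m)"
    using LU onb_mat_imp_Gr[OF LU] Lb by (auto simp: onb_mat_def orthonormal_basis_def)

  have 2: "equichordal (r * k) (r * m) n Wbar \<longleftrightarrow> equichordal k m n W"
  proof -
    have "inj ((*) (of_nat r :: 'a))" using r0 by (auto intro!: injI)
    from constant_inj_iff[OF this, of n "\<lambda>i j. mat_trace (?G i j)"] show ?thesis
      unfolding equichordal_iff[OF onb(1)] equichordal_iff[OF onb(2)]
      by (simp add: G mat_trace_kronecker_one[OF Gc])
  qed

  have 3: "strongly_simplicial (r * k) (r * m) n Wbar \<longleftrightarrow> strongly_simplicial k m n W"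
  proof -
    have "inj (repeat_mset r :: 'a multiset \<Rightarrow> _)"
      using r0 by (auto intro!: injI simp: multiset_eq_iff)
    from constant_inj_iff[OF this, of n "\<lambda>i j. proots (char_poly (?G i j))"] show ?thesis
      unfolding strongly_simplicial_iff[OF onb(1)] strongly_simplicial_iff[OF onb(2)]
      by (simp add: G char_poly_kronecker_one[OF Gc] proots_power)
  qed

  have 4: "equiisoclinic (r * k) (r * m) n Wbar \<longleftrightarrow> equiisoclinic k m n W"
  proof -
    have "kronecker (?G i j) (1\<^sub>m r) = of_real \<alpha> \<cdot>\<^sub>m 1\<^sub>m (r * m) \<longleftrightarrow> ?G i j = of_real \<alpha> \<cdot>\<^sub>m 1\<^sub>m m"
      if "i < n" for i j \<alpha>
    proof -
      have "of_real \<alpha> \<cdot>\<^sub>m 1\<^sub>m (r * m) = kronecker (of_real \<alpha> \<cdot>\<^sub>m 1\<^sub>m m) (1\<^sub>m r :: 'a mat)"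
        by (simp add: kronecker_smult_left kronecker_one_one mult.commute)
      then show ?thesis
        using kronecker_one_inj[OF Gc[OF that] _ r0] by auto
    qed
    then show ?thesis
      unfolding equiisoclinic_iff[OF onb(1)] equiisoclinic_iff[OF onb(2)] by (simp add: G)
  qed

  have 5: "saturates_orthoplex (r * k) (r * m) n Wbar \<longleftrightarrow> saturates_orthoplex k m n W"
    by (rule saturates_orthoplex_scale[OF r0], rule chordal_dist_scale) (use P Pbar in auto)

  have 6: "r \<ge> 2 \<longrightarrow>
      \<not> (orthoplectic_packing (r * k) (r * m) n Wbar \<and> orthoplectic_packing k m n W)"
    using zdim_growth[of r k, where 'a = 'a] unfolding orthoplectic_packing_def by linarith

  have bound: "fusion_frame_bound (r * k) n Wbar A \<longleftrightarrow> fusion_frame_bound k n W A" for A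
    by (rule fusion_frame_bound_kronecker[OF P Pbar r0])
  have 7: "tight_fusion_frame (r * k) n Wbar \<longleftrightarrow> tight_fusion_frame k n W"
    by (simp only: tight_fusion_frame_def bound)
  have "A = B" if "fusion_frame_bound k n W A" "fusion_frame_bound (r * k) n Wbar B" for A B
    by (rule fusion_frame_bound_unique[OF P _ that(1) that(2)[unfolded bound]]) (use m in auto)
  then have 8: "\<forall>A B. fusion_frame_bound k n W A \<and> fusion_frame_bound (r * k) n Wbar B \<longrightarrow> A = B"
    by iprover
  show ?thesis
    by (intro conjI 1 2 3 4 5 6 7 8)
qed

end
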